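(* Let $G$ be an $r$-regular graph of order $n$. Then (i) $\gamma^{NN}_{s}(G)=n-2L_{\lfloor\frac{r+1}{2}\rfloor}(G)$; (ii) $\gamma^{NN}_{s}(G)=2\gamma_{\times\lceil\frac{r+1}{2}\rceil}(G)-n$.
   Context: All graphs are finite and simple. For a vertex $v$, $N[v]$ denotes its closed neighborhood $N(v)\cup\{v\}$; for $f:V(G)\to\mathbb{R}$ and $S\subseteq V(G)$, $f(S)=\sum_{v\in S}f(v)$. A nonnegative signed dominating function (NNSDF) of $G$ is a function $f:V(G)\to\{-1,1\}$ with $f(N[v])\ge 0$ for every $v\in V(G)$; the nonnegative signed domination number $\gamma^{NN}_s(G)$ is the minimum of $f(V(G))$ over all NNSDFs $f$ of $G$. A set $B\subseteq V(G)$ is a $k$-limited packing if $|N[v]\cap B|\le k$ for all $v\in V(G)$; $L_k(G)$ is the maximum size of a $k$-limited packing. A set $D\subseteq V(G)$ is a $k$-tuple dominating set if $|N[v]\cap D|\ge k$ for all $v\in V(G)$; $\gamma_{\times k}(G)$ is the minimum size of a $k$-tuple dominating set. *)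

theory Defs
  imports Complex_Main "HOL-Library.FuncSet" "Graph_Theory.Digraph"
begin

text \<open>
  A finite simple graph is a digraph satisfying the locale predicate \<^const>\<open>graph\<close>: finite,
  loop-free, without parallel arcs, and symmetric.  An undirected edge is a pair of opposite arcs.
\<close>

definition neighborhood :: "('a, 'b) pre_digraph \<Rightarrow> 'a \<Rightarrow> 'a set" where
  "neighborhood G v = {u. v \<rightarrow>\<^bsub>G\<^esub> u}"

definition closed_neighborhood :: "('a, 'b) pre_digraph \<Rightarrow> 'a \<Rightarrow> 'a set" where
  "closed_neighborhood G v = neighborhood G v \<union> {v}"

definition regular_graph :: "('a, 'b) pre_digraph \<Rightarrow> nat \<Rightarrow> bool" where
  "regular_graph G r \<longleftrightarrow> graph G \<and> (\<forall>v \<in> verts G. card (neighborhood G v) = r)"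

definition nnsdf :: "('a, 'b) pre_digraph \<Rightarrow> ('a \<Rightarrow> int) \<Rightarrow> bool" where
  "nnsdf G f \<longleftrightarrow> f \<in> verts G \<rightarrow>\<^sub>E {-1, 1} \<and>
     (\<forall>v \<in> verts G. (\<Sum>u \<in> closed_neighborhood G v. f u) \<ge> 0)"

definition nnsd_number :: "('a, 'b) pre_digraph \<Rightarrow> int" where
  "nnsd_number G = Min {\<Sum>v \<in> verts G. f v | f. nnsdf G f}"

definition limited_packing :: "('a, 'b) pre_digraph \<Rightarrow> nat \<Rightarrow> 'a set \<Rightarrow> bool" where
  "limited_packing G k B \<longleftrightarrow> B \<subseteq> verts G \<and>
     (\<forall>v \<in> verts G. card (closed_neighborhood G v \<inter> B) \<le> k)"

definition limited_packing_number :: "('a, 'b) pre_digraph \<Rightarrow> nat \<Rightarrow> nat" where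
  "limited_packing_number G k = Max {card B | B. limited_packing G k B}"

definition tuple_dominating :: "('a, 'b) pre_digraph \<Rightarrow> nat \<Rightarrow> 'a set \<Rightarrow> bool" where
  "tuple_dominating G k D \<longleftrightarrow> D \<subseteq> verts G \<and>
     (\<forall>v \<in> verts G. card (closed_neighborhood G v \<inter> D) \<ge> k)"

text \<open>
  A \<open>k\<close>-tuple dominating set exists iff \<open>k\<close> is at most the minimum degree plus one;
  otherwise the \<^const>\<open>Min\<close> below is taken over the empty set and is unspecified.
\<close>

definition tuple_domination_number :: "('a, 'b) pre_digraph \<Rightarrow> nat \<Rightarrow> nat" where
  "tuple_domination_number G k = Min {card D | D. tuple_dominating G k D}"

end

theory Submission
  imports Defs
begin

text \<open>
  A function \<open>V \<rightarrow> {-1, 1}\<close> is determined by the set \<open>D\<close> where it takes the value 1, and its sum over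
  a set \<open>S\<close> is \<open>2 |S \<inter> D| - |S|\<close>.  As every closed neighbourhood has \<open>r + 1\<close> elements, the function
  is an NNSDF iff \<open>D\<close> is a \<open>\<lceil>(r + 1) / 2\<rceil>\<close>-tuple dominating set, and iff the complement of \<open>D\<close> is
  a \<open>\<lfloor>(r + 1) / 2\<rfloor>\<close>-limited packing.
\<close>

text \<open>The restriction to \<open>V\<close> gives the value \<open>undefined\<close> elsewhere,
  as the extensional space \<open>V \<rightarrow>\<^sub>E {-1, 1}\<close> in \<open>nnsdf\<close>
  demands.\<close>

definition sign_fun :: "'a set \<Rightarrow> 'a set \<Rightarrow> 'a \<Rightarrow> int" where
  "sign_fun V D = (\<lambda>v\<in>V. if v \<in> D then 1 else -1)"

lemma sum_sign_fun:
  assumes "finite V" "S \<subseteq> V"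
  shows "(\<Sum>v\<in>S. sign_fun V D v) = 2 * int (card (S \<inter> D)) - int (card S)"
proof -
  have "finite S"
    using assms finite_subset by blast
  have "(\<Sum>v\<in>S. sign_fun V D v) = (\<Sum>v\<in>S. 2 * (if v \<in> D then 1 else 0) - 1)"
    using assms(2) by (intro sum.cong) (auto simp: sign_fun_def)
  also have "\<dots> = 2 * (\<Sum>v\<in>S. if v \<in> D then 1 else 0) - int (card S)"
    by (simp add: sum_subtractf sum_distrib_left)
  also have "(\<Sum>v\<in>S. if v \<in> D then 1 else 0) = int (card (S \<inter> D))"
    using \<open>finite S\<close> by (simp add: sum.If_cases)
  finally show ?thesis .
qed

lemma PiE_signs_eq: "V \<rightarrow>\<^sub>E {-1, 1} = sign_fun V ` Pow V"
proof
  show "V \<rightarrow>\<^sub>E {-1, 1} \<subseteq> sign_fun V ` Pow V"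
  proof
    fix f :: "'a \<Rightarrow> int"
    assume f: "f \<in> V \<rightarrow>\<^sub>E {-1, 1}"
    have "f = sign_fun V {v \<in> V. f v = 1}"
    proof
      fix v
      show "f v = sign_fun V {v \<in> V. f v = 1} v"
        \<comment> \<open>On \<open>V\<close> the value is 1 or -1; off \<open>V\<close> both sides
          are \<open>undefined\<close>, by \<open>PiE_arb\<close>.\<close>
        using PiE_mem[OF f, of v] PiE_arb[OF f, of v] by (auto simp: sign_fun_def)
    qed
    then show "f \<in> sign_fun V ` Pow V"
      by blast
  qed
qed (auto simp: sign_fun_def split: if_splits)

text \<open>Moves the minimum from functions to vertex subsets, the objects that packings and
  dominating sets are.\<close>

lemma nnsdf_weights_eq:
  "{\<Sum>v\<in>verts G. f v | f. nnsdf G f} =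
    {\<Sum>v\<in>verts G. sign_fun (verts G) D v | D. D \<subseteq> verts G \<and> nnsdf G (sign_fun (verts G) D)}"
proof -
  have "nnsdf G f \<longleftrightarrow> (\<exists>D \<subseteq> verts G. f = sign_fun (verts G) D \<and> nnsdf G f)" for f
    using PiE_signs_eq[of "verts G"] by (auto simp: nnsdf_def)
  then show ?thesis
    by (intro Collect_cong) metis
qed

lemma closed_neighborhood_subset:
  assumes "graph G" "v \<in> verts G"
  shows "closed_neighborhood G v \<subseteq> verts G"
proof -
  interpret graph G by fact
  show ?thesis
    using assms(2) adj_in_verts by (auto simp: closed_neighborhood_def neighborhood_def)
qed

lemma card_closed_neighborhood:
  assumes "regular_graph G r" "v \<in> verts G"
  shows "card (closed_neighborhood G v) = r + 1"
proof -
  interpret graph G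
    using assms(1) by (simp add: regular_graph_def)
  \<comment> \<open>Loop-freeness makes \<open>v\<close> a new element of its closed neighborhood,
    hence the extra 1.\<close>
  have "v \<notin> neighborhood G v"
    using adj_not_same by (auto simp: neighborhood_def)
  moreover have "finite (neighborhood G v)"
    using closed_neighborhood_subset[OF graph_axioms assms(2)] finite_verts
    by (auto simp: closed_neighborhood_def intro: finite_subset)
  ultimately show ?thesis
    using assms by (simp add: closed_neighborhood_def regular_graph_def)
qed

text \<open>Since \<open>m\<close> is an integer, comparing it with the rounded half is the same as
  comparing it with the half itself. The same holds for the floor below, so the parity of
  \<open>r\<close> never matters.\<close>

lemma nat_ceiling_le_iff_half: "nat \<lceil>(real r + 1) / 2\<rceil> \<le> m \<longleftrightarrow> r + 1 \<le> 2 * m"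
  by (simp add: nat_le_iff ceiling_le_iff) linarith

lemma le_nat_floor_iff_half: "m \<le> nat \<lfloor>(real r + 1) / 2\<rfloor> \<longleftrightarrow> 2 * m \<le> r + 1"
  by (simp add: le_nat_iff le_floor_iff) linarith

text \<open>Regularity turns every neighborhood sum into
  \<open>2 * card (closed_neighborhood G v \<inter> D) - (r + 1)\<close>, with one constant for all
  \<open>v\<close>. This rounding-free form serves both characterizations.\<close>

lemma nnsdf_sign_fun_iff:
  assumes "regular_graph G r" "D \<subseteq> verts G"
  shows "nnsdf G (sign_fun (verts G) D) \<longleftrightarrow>
    (\<forall>v\<in>verts G. r + 1 \<le> 2 * card (closed_neighborhood G v \<inter> D))"
proof -
  interpret graph G
    using assms(1) by (simp add: regular_graph_def)
  have "sign_fun (verts G) D \<in> verts G \<rightarrow>\<^sub>E {-1, 1}"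
    by (simp add: PiE_signs_eq assms(2))
  moreover have "(\<Sum>u\<in>closed_neighborhood G v. sign_fun (verts G) D u)
      = 2 * int (card (closed_neighborhood G v \<inter> D)) - int (r + 1)" if "v \<in> verts G" for v
    using that assms
    by (simp add: sum_sign_fun closed_neighborhood_subset card_closed_neighborhood graph_axioms)
  ultimately show ?thesis
    by (fastforce simp: nnsdf_def)
qed

lemma nnsdf_iff_tuple_dominating:
  assumes "regular_graph G r" "D \<subseteq> verts G"
  shows "nnsdf G (sign_fun (verts G) D) \<longleftrightarrow> tuple_dominating G (nat \<lceil>(real r + 1) / 2\<rceil>) D"
  using assms by (simp only: nnsdf_sign_fun_iff tuple_dominating_def nat_ceiling_le_iff_half simp_thms)

text \<open>\<open>B\<close> and its complement split the \<open>r + 1\<close> elements of each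
  closed neighborhood, so one part has at least half of them iff the other has at most half.\<close>

lemma nnsdf_iff_limited_packing:
  assumes "regular_graph G r" "B \<subseteq> verts G"
  shows "nnsdf G (sign_fun (verts G) (verts G - B)) \<longleftrightarrow>
    limited_packing G (nat \<lfloor>(real r + 1) / 2\<rfloor>) B"
proof -
  interpret graph G
    using assms(1) by (simp add: regular_graph_def)
  have "card (closed_neighborhood G v \<inter> B) + card (closed_neighborhood G v \<inter> (verts G - B)) = r + 1"
    if "v \<in> verts G" for v
  proof -
    let ?N = "closed_neighborhood G v"
    have N: "?N \<subseteq> verts G"
      using that by (simp add: closed_neighborhood_subset graph_axioms)
    then have "finite ?N"
      using finite_verts finite_subset by blast
    then have "card (?N \<inter> B) + card (?N - B) = card ?N"
      by (metis card_Int_Diff)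
    moreover have "?N \<inter> (verts G - B) = ?N - B"
      using N by blast
    ultimately show ?thesis
      using that assms(1) by (simp add: card_closed_neighborhood)
  qed
  then have "r + 1 \<le> 2 * card (closed_neighborhood G v \<inter> (verts G - B)) \<longleftrightarrow>
      2 * card (closed_neighborhood G v \<inter> B) \<le> r + 1" if "v \<in> verts G" for v
    using that by fastforce
  then show ?thesis
    using assms by (simp only: nnsdf_sign_fun_iff limited_packing_def le_nat_floor_iff_half
        Diff_subset simp_thms cong: ball_cong)
qed

text \<open>Decreasing counterpart of \<open>mono_Min_commute\<close>, for the part where the
  minimum weight comes from a largest packing.\<close>

lemma Min_image_antimono:
  fixes f :: "'a::linorder \<Rightarrow> 'b::linorder"
  assumes "antimono f" "finite A" "A \<noteq> {}"
  shows "Min (f ` A) = f (Max A)"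
  using assms by (intro Min_eqI) (auto intro: antimonoD)

theorem theorem2p1:
  fixes G :: "('a, 'b) pre_digraph" and r n :: nat
  assumes "regular_graph G r"
    and "card (verts G) = n"
  shows "nnsd_number G = int n - 2 * int (limited_packing_number G (nat \<lfloor>(real r + 1) / 2\<rfloor>))
      \<and> nnsd_number G = 2 * int (tuple_domination_number G (nat \<lceil>(real r + 1) / 2\<rceil>)) - int n"
proof -
  interpret graph G
    using assms(1) by (simp add: regular_graph_def)
  define V where "V = verts G"
  define k where "k = nat \<lfloor>(real r + 1) / 2\<rfloor>"
  define l where "l = nat \<lceil>(real r + 1) / 2\<rceil>"
  define W where "W = {\<Sum>v\<in>V. f v | f. nnsdf G f}"
  define P where "P = {card B | B. limited_packing G k B}"
  define T where "T = {card D | D. tuple_dominating G l D}"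
  have "finite V"
    by (simp add: V_def)
  have W: "W = {\<Sum>v\<in>V. sign_fun V D v | D. D \<subseteq> V \<and> nnsdf G (sign_fun V D)}"
    by (simp only: W_def V_def nnsdf_weights_eq)
  have weight: "(\<Sum>v\<in>V. sign_fun V D v) = 2 * int (card D) - int n" if "D \<subseteq> V" for D
    using that assms(2) \<open>finite V\<close> by (simp add: sum_sign_fun Int_absorb1 flip: V_def)
  have WT: "W = (\<lambda>m. 2 * int m - int n) ` T"
  proof -
    have "tuple_dominating G l D \<longleftrightarrow> D \<subseteq> V \<and> nnsdf G (sign_fun V D)" for D
      using nnsdf_iff_tuple_dominating[OF assms(1), of D]
      by (auto simp: V_def l_def tuple_dominating_def)
    then show ?thesis
      unfolding W T_def using weight by (auto simp: image_iff) metis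
  qed
  have WP: "W = (\<lambda>m. int n - 2 * int m) ` P"
  proof -
    have P: "limited_packing G k B \<longleftrightarrow> B \<subseteq> V \<and> nnsdf G (sign_fun V (V - B))" for B
      using nnsdf_iff_limited_packing[OF assms(1), of B]
      by (auto simp: V_def k_def limited_packing_def)
    have weight': "(\<Sum>v\<in>V. sign_fun V (V - B) v) = int n - 2 * int (card B)" if "B \<subseteq> V" for B
    proof -
      have "card B + card (V - B) = n"
        using that \<open>finite V\<close> assms(2) by (metis V_def card_Int_Diff inf.absorb2)
      then show ?thesis
        using weight[of "V - B"] by simp
    qed
    \<comment> \<open>Complementation is an involution on the subsets of \<open>V\<close>, so
      \<open>D\<close> may be written as \<open>V - B\<close>.\<close>
    have "W = {\<Sum>v\<in>V. sign_fun V (V - B) v | B. B \<subseteq> V \<and> nnsdf G (sign_fun V (V - B))}"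
      unfolding W by (metis (lifting) Diff_subset double_diff subset_refl)
    then show ?thesis
      unfolding P_def P using weight' by (auto simp: image_iff)
  qed
  have "finite P" "finite T"
    using \<open>finite V\<close> finite_subset[of _ "card ` Pow V"]
    by (auto simp: P_def T_def V_def limited_packing_def tuple_dominating_def)
  \<comment> \<open>The empty packing shows that no extremum here is over an empty set:
    \<open>P\<close> is nonempty, hence so is its image \<open>W\<close>, hence so is
    \<open>T\<close>.\<close>
  have "limited_packing G k {}"
    by (simp add: limited_packing_def)
  then have "P \<noteq> {}"
    by (auto simp: P_def)
  then have "T \<noteq> {}"
    using WP WT by auto
  have "nnsd_number G = Min W"
    by (simp add: nnsd_number_def W_def V_def)
  \<comment> \<open>\<open>W\<close> is a decreasing image of \<open>P\<close> and an increasing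
    image of \<open>T\<close>, so its minimum sits at \<open>Max P\<close> and at
    \<open>Min T\<close>.\<close>
  moreover have "Min W = int n - 2 * int (Max P)"
    unfolding WP using \<open>finite P\<close> \<open>P \<noteq> {}\<close> by (intro Min_image_antimono) (auto simp: antimono_def)
  moreover have "Min W = 2 * int (Min T) - int n"
    unfolding WT using \<open>finite T\<close> \<open>T \<noteq> {}\<close>
    by (intro mono_Min_commute[symmetric]) (auto simp: mono_def)
  ultimately show ?thesis
    by (simp add: limited_packing_number_def tuple_domination_number_def P_def T_def k_def l_def)
qed

end
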